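(* Let $n\ge 2$ and let $K, L$ be two smooth operator fields on an $n$-dimensional manifold that commute in the algebraic sense, i.e. $KL=LK$ pointwise, and such that in a local coordinate system $x_1,\dots,x_n$ they are both given by strictly upper triangular matrices. Then the generalized Haantjes bracket $\mathcal H^{(n-1)}_{K,L}$ of level $n-1$ vanishes (on the domain of this coordinate system).
   Context: An operator field on a manifold is a tensor field of type $(1,1)$, i.e. a field of endomorphisms of the tangent spaces. In local coordinates $x_1,\dots,x_n$ its matrix $(L^i_j)$ is given by $L\,\partial_{x_j}=\sum_i L^i_j\,\partial_{x_i}$. The matrix is strictly upper triangular if $L^i_j=0$ for all $i\ge j$ at all points of the coordinate neighbourhood. For a pair of operator fields $K,L$, the Frölicher–Nijenhuis bracket is the tensor field $[[K,L]]$ of type $(1,2)$ defined, for vector fields $\xi,\eta$, by $$\begin{aligned}[][[K,L]](\xi,\eta)&=[K\xi,L\eta]+[L\xi,K\eta]-L[K\xi,\eta]-L[\xi,K\eta]\\&\quad-K[L\xi,\eta]-K[\xi,L\eta]+LK[\xi,\eta]+KL[\xi,\eta],\end{aligned}$$ where $[\cdot,\cdot]$ on the right-hand side is the Lie bracket of vector fields. The generalized Haantjes brackets $\mathcal H^{(m)}_{K,L}$ of level $m\ge 1$ are the tensor fields of type $(1,2)$ defined recursively by $\mathcal H^{(1)}_{K,L}(\xi,\eta)=[[K,L]](\xi,\eta)$ and, for $m\ge 2$, $$\begin{aligned} \mathcal H^{(m)}_{K,L}(\xi,\eta)={}&KL\,\mathcal H^{(m-1)}_{K,L}(\xi,\eta)+\mathcal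 H^{(m-1)}_{K,L}(K\xi,L\eta)-L\,\mathcal H^{(m-1)}_{K,L}(K\xi,\eta)-K\,\mathcal H^{(m-1)}_{K,L}(\xi,L\eta)\\ &+LK\,\mathcal H^{(m-1)}_{K,L}(\xi,\eta)+\mathcal H^{(m-1)}_{K,L}(L\xi,K\eta)-K\,\mathcal H^{(m-1)}_{K,L}(L\xi,\eta)-L\,\mathcal H^{(m-1)}_{K,L}(\xi,K\eta). \end{aligned}$$ *)

theory Defs
  imports "HOL-Analysis.Analysis" "HOL-Library.Function_Algebras"
begin

fun Ck_on :: "nat \<Rightarrow> 'a::real_normed_vector set \<Rightarrow> ('a \<Rightarrow> 'b::real_normed_vector) \<Rightarrow> bool" where
  "Ck_on 0 S f \<longleftrightarrow> continuous_on S f"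
| "Ck_on (Suc k) S f \<longleftrightarrow>
     f differentiable_on S \<and> (\<forall>v. Ck_on k S (\<lambda>x. frechet_derivative f (at x) v))"

text \<open>Only used on open subsets of finite-dimensional spaces, where requiring all iterated
  directional derivatives to exist and to be continuous is the usual notion.\<close>

definition smooth_on :: "'a::real_normed_vector set \<Rightarrow> ('a \<Rightarrow> 'b::real_normed_vector) \<Rightarrow> bool" where
  "smooth_on S f \<longleftrightarrow> (\<forall>k. Ck_on k S f)"


text \<open>A chart is a pair of its domain and its coordinate map; the values of the
  coordinate map outside the domain carry no meaning. The coordinates
  are indexed by a finite linearly ordered type \<open>'n\<close>, which plays the role of \<open>1 < \<dots> < n\<close>,
  so the dimension is \<open>CARD('n)\<close>.\<close>

type_synonym ('m, 'n) chart = "'m set \<times> ('m \<Rightarrow> real ^ 'n)"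

definition chart_img :: "('m, 'n) chart \<Rightarrow> 'm set \<Rightarrow> (real ^ 'n) set" where
  "chart_img c W = snd c ` (fst c \<inter> W)"

definition is_chart :: "('m::topological_space, 'n::finite) chart \<Rightarrow> bool" where
  "is_chart c \<longleftrightarrow> open (fst c) \<and> open (snd c ` fst c) \<and>
     homeomorphism (fst c) (snd c ` fst c) (snd c) (inv_into (fst c) (snd c))"

definition transition :: "('m, 'n) chart \<Rightarrow> ('m, 'n) chart \<Rightarrow> real ^ 'n \<Rightarrow> real ^ 'n" where
  "transition c d = snd d \<circ> inv_into (fst c) (snd c)"

definition compatible :: "('m, 'n::finite) chart \<Rightarrow> ('m, 'n) chart \<Rightarrow> bool" where
  "compatible c d \<longleftrightarrow>
     smooth_on (chart_img c (fst d)) (transition c d) \<and>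
     smooth_on (chart_img d (fst c)) (transition d c)"

text \<open>The type \<open>'m\<close> is the underlying space of the manifold and \<open>A\<close> is its maximal atlas,
  so the members of \<open>A\<close> are exactly the local coordinate systems.\<close>

definition smooth_structure ::
    "('m::{t2_space, second_countable_topology}, 'n::finite) chart set \<Rightarrow> bool" where
  "smooth_structure A \<longleftrightarrow>
     (\<forall>c\<in>A. is_chart c) \<and>
     (\<Union>c\<in>A. fst c) = UNIV \<and>
     (\<forall>c\<in>A. \<forall>d\<in>A. compatible c d) \<and>
     (\<forall>c. is_chart c \<and> (\<forall>d\<in>A. compatible c d) \<longrightarrow> c \<in> A)"


text \<open>Tensor fields are given by their components in every chart \<open>c\<close>, as functions of the coordinates
  of \<open>c\<close>, subject to the tensor transformation law on overlaps.\<close>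

type_synonym ('m, 'n) vfield = "('m, 'n) chart \<Rightarrow> real ^ 'n \<Rightarrow> real ^ 'n"
type_synonym ('m, 'n) opfield = "('m, 'n) chart \<Rightarrow> real ^ 'n \<Rightarrow> real ^ 'n ^ 'n"

definition vector_field_on ::
    "('m, 'n::finite) chart set \<Rightarrow> 'm set \<Rightarrow> ('m, 'n) vfield \<Rightarrow> bool" where
  "vector_field_on A W \<xi> \<longleftrightarrow>
     (\<forall>c\<in>A. smooth_on (chart_img c W) (\<xi> c)) \<and>
     (\<forall>c\<in>A. \<forall>d\<in>A. \<forall>x\<in>chart_img c (fst d \<inter> W).
        \<xi> d (transition c d x) = jacobian (transition c d) (at x) *v \<xi> c x)"

text \<open>\<open>K c x $ i $ j\<close> is the component with upper index \<open>i\<close> and lower index \<open>j\<close>: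
  \<open>K c x *v axis j 1\<close>, the image of the \<open>j\<close>-th coordinate vector, is the \<open>j\<close>-th column.\<close>

definition operator_field :: "('m, 'n::finite) chart set \<Rightarrow> ('m, 'n) opfield \<Rightarrow> bool" where
  "operator_field A K \<longleftrightarrow>
     (\<forall>c\<in>A. smooth_on (chart_img c UNIV) (K c)) \<and>
     (\<forall>c\<in>A. \<forall>d\<in>A. \<forall>x\<in>chart_img c (fst d).
        K d (transition c d x) ** jacobian (transition c d) (at x) =
        jacobian (transition c d) (at x) ** K c x)"

definition op_apply :: "('m, 'n::finite) opfield \<Rightarrow> ('m, 'n) vfield \<Rightarrow> ('m, 'n) vfield"
    (infixr "\<rhd>" 75) where
  "K \<rhd> \<xi> = (\<lambda>c x. K c x *v \<xi> c x)"

definition commuting_operators ::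
    "('m, 'n::finite) chart set \<Rightarrow> ('m, 'n) opfield \<Rightarrow> ('m, 'n) opfield \<Rightarrow> bool" where
  "commuting_operators A K L \<longleftrightarrow>
     (\<forall>c\<in>A. \<forall>x\<in>chart_img c UNIV. K c x ** L c x = L c x ** K c x)"

definition strictly_upper_triangular_in ::
    "('m, 'n::{finite, linorder}) chart \<Rightarrow> ('m, 'n) opfield \<Rightarrow> bool" where
  "strictly_upper_triangular_in c K \<longleftrightarrow>
     (\<forall>x\<in>chart_img c UNIV. \<forall>i j. i \<ge> j \<longrightarrow> K c x $ i $ j = 0)"

text \<open>In coordinates, the \<open>i\<close>-th component of the Lie bracket is
  \<open>\<Sum>j. \<xi>\<^sup>j \<partial>\<^sub>j \<eta>\<^sup>i - \<eta>\<^sup>j \<partial>\<^sub>j \<xi>\<^sup>i\<close>.\<close>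

definition lie_bracket :: "('m, 'n::finite) vfield \<Rightarrow> ('m, 'n) vfield \<Rightarrow> ('m, 'n) vfield" where
  "lie_bracket \<xi> \<eta> = (\<lambda>c x.
     frechet_derivative (\<eta> c) (at x) (\<xi> c x) - frechet_derivative (\<xi> c) (at x) (\<eta> c x))"

definition fn_bracket :: "('m, 'n::finite) opfield \<Rightarrow> ('m, 'n) opfield \<Rightarrow>
    ('m, 'n) vfield \<Rightarrow> ('m, 'n) vfield \<Rightarrow> ('m, 'n) vfield" where
  "fn_bracket K L \<xi> \<eta> =
     lie_bracket (K \<rhd> \<xi>) (L \<rhd> \<eta>) + lie_bracket (L \<rhd> \<xi>) (K \<rhd> \<eta>)
     - L \<rhd> lie_bracket (K \<rhd> \<xi>) \<eta> - L \<rhd> lie_bracket \<xi> (K \<rhd> \<eta>)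
     - K \<rhd> lie_bracket (L \<rhd> \<xi>) \<eta> - K \<rhd> lie_bracket \<xi> (L \<rhd> \<eta>)
     + L \<rhd> K \<rhd> lie_bracket \<xi> \<eta> + K \<rhd> L \<rhd> lie_bracket \<xi> \<eta>"

text \<open>Levels start at 1; level 0 is left unspecified.\<close>

fun haantjes_bracket :: "nat \<Rightarrow> ('m, 'n::finite) opfield \<Rightarrow> ('m, 'n) opfield \<Rightarrow>
    ('m, 'n) vfield \<Rightarrow> ('m, 'n) vfield \<Rightarrow> ('m, 'n) vfield" where
  "haantjes_bracket (Suc 0) K L \<xi> \<eta> = fn_bracket K L \<xi> \<eta>"
| "haantjes_bracket (Suc (Suc m)) K L \<xi> \<eta> =
     (let H = haantjes_bracket (Suc m) K L in
       K \<rhd> L \<rhd> H \<xi> \<eta> + H (K \<rhd> \<xi>) (L \<rhd> \<eta>)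
       - L \<rhd> H (K \<rhd> \<xi>) \<eta> - K \<rhd> H \<xi> (L \<rhd> \<eta>)
       + L \<rhd> K \<rhd> H \<xi> \<eta> + H (L \<rhd> \<xi>) (K \<rhd> \<eta>)
       - K \<rhd> H (L \<rhd> \<xi>) \<eta> - L \<rhd> H \<xi> (K \<rhd> \<eta>))"

text \<open>The tensor field \<open>haantjes_bracket m K L\<close> is zero on the domain of \<open>c\<close> if its values on
  vector fields defined there have zero components in the coordinates of \<open>c\<close>. Quantifying over
  vector fields on the domain covers the coordinate fields as well as restrictions of global ones.\<close>

definition haantjes_vanishes_on_chart :: "('m, 'n::finite) chart set \<Rightarrow> ('m, 'n) chart \<Rightarrow>
    nat \<Rightarrow> ('m, 'n) opfield \<Rightarrow> ('m, 'n) opfield \<Rightarrow> bool" where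
  "haantjes_vanishes_on_chart A c m K L \<longleftrightarrow>
     (\<forall>\<xi> \<eta>. vector_field_on A (fst c) \<xi> \<longrightarrow> vector_field_on A (fst c) \<eta> \<longrightarrow>
        (\<forall>x\<in>chart_img c UNIV. haantjes_bracket m K L \<xi> \<eta> c x = 0))"

end

theory Submission
  imports Defs
begin

text \<open>The brackets are tensorial, so everything happens at a single point of the chart. Grade the
  component of a bilinear map \<open>T\<close> with input indices \<open>i\<close>, \<open>j\<close> and output index \<open>k\<close> by \<open>i + j - k\<close>:
  composing \<open>T\<close> with a strictly upper triangular matrix, in either argument or in the value, raises
  the least degree occurring in \<open>T\<close> by one. The derivative \<open>(\<partial>\<^sub>u K) v\<close> has least degree 2,
  hence \<open>[[K,L]]\<close> has least degree 3, and each further level adds 2. At level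
  \<open>n - 1\<close> the least degree is \<open>2 * n - 1\<close>, which forces \<open>i = j = n\<close> and \<open>k = 1\<close>; this
  component vanishes because the brackets are antisymmetric.\<close>

section \<open>The flag of coordinate subspaces\<close>

definition position :: "'n::{finite, linorder} \<Rightarrow> int" where
  "position i = int (card {..i})"

lemma position_ge_1: "1 \<le> position i"
  using card_gt_0_iff[of "{..i}"] by (fastforce simp: position_def)

lemma position_less: "i < j \<Longrightarrow> position i < position j"
  unfolding position_def by (auto intro!: psubset_card_mono)

lemma position_le_CARD: "position (i::'n::{finite, linorder}) \<le> int CARD('n)"
  unfolding position_def by (simp add: card_mono)

lemma position_less_CARD:
  assumes "i \<noteq> (Max UNIV :: 'n::{finite, linorder})"
  shows "position i < int CARD('n)"
  using position_less[of i "Max UNIV"] position_le_CARD[of "Max UNIV :: 'n"] assms Max_ge[of UNIV i]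
  by fastforce

text \<open>The complete flag of coordinate subspaces, indexed by all integers: it is zero for
  \<open>p\<close> at most 0 and the whole space from the dimension on. Integer indices let levels
  drop below zero without truncation.\<close>

definition flag :: "int \<Rightarrow> (real ^ 'n::{finite, linorder}) set" where
  "flag p = {v. \<forall>i. position i > p \<longrightarrow> v $ i = 0}"

lemma flag_mono: "v \<in> flag p \<Longrightarrow> p \<le> q \<Longrightarrow> v \<in> flag q"
  by (auto simp: flag_def)

lemma zero_in_flag: "0 \<in> flag p"
  and add_in_flag: "u \<in> flag p \<Longrightarrow> v \<in> flag p \<Longrightarrow> u + v \<in> flag p"
  and diff_in_flag: "u \<in> flag p \<Longrightarrow> v \<in> flag p \<Longrightarrow> u - v \<in> flag p"
  by (auto simp: flag_def)

lemma flag_nonpos: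
  fixes v :: "real ^ 'n::{finite, linorder}"
  assumes "v \<in> flag p" "p \<le> 0"
  shows "v = 0"
proof -
  have "p < position i" for i :: 'n using assms(2) position_ge_1[of i] by linarith
  then show ?thesis using assms(1) by (simp add: flag_def vec_eq_iff)
qed

lemma in_flag_CARD: "(v :: real ^ 'n::{finite, linorder}) \<in> flag (int CARD('n))"
  using position_le_CARD by (force simp: flag_def not_less[symmetric])

lemma diff_top_in_flag:
  fixes v :: "real ^ 'n::{finite, linorder}"
  shows "v - v $ Max UNIV *\<^sub>R axis (Max UNIV) 1 \<in> flag (int CARD('n) - 1)"
  unfolding flag_def
proof (intro CollectI allI impI)
  fix i :: 'n
  assume "int CARD('n) - 1 < position i"
  then have "i = Max UNIV" using position_less_CARD[of i] by linarith
  then show "(v - v $ Max UNIV *\<^sub>R axis (Max UNIV) 1) $ i = 0" by (simp add: axis_def)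
qed

section \<open>Strictly upper triangular matrices and degrees of bilinear maps\<close>

type_synonym 'n sqmat = "((real, 'n) vec, 'n) vec"
type_synonym 'n btensor = "(real, 'n) vec \<Rightarrow> (real, 'n) vec \<Rightarrow> (real, 'n) vec"

definition strictly_upper :: "'n::{finite, linorder} sqmat \<Rightarrow> bool" where
  "strictly_upper k \<longleftrightarrow> (\<forall>i j. i \<ge> j \<longrightarrow> k $ i $ j = 0)"

text \<open>Row \<open>i\<close> of the matrix only meets entries of \<open>v\<close> at later
  positions, and for \<open>i\<close> beyond \<open>p - 1\<close> those lie beyond \<open>p\<close>,
  where \<open>v\<close> vanishes.\<close>

lemma strictly_upper_flag:
  fixes k :: "'n::{finite, linorder} sqmat"
  assumes "strictly_upper k" "v \<in> flag p"
  shows "k *v v \<in> flag (p - 1)"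
  unfolding flag_def
proof (intro CollectI allI impI)
  fix i :: 'n
  assume i: "p - 1 < position i"
  have "k $ i $ j * v $ j = 0" for j
  proof (cases "j \<le> i")
    case True
    then show ?thesis using assms(1) by (simp add: strictly_upper_def)
  next
    case False
    then have "position i < position j" by (intro position_less) simp
    then have "p < position j" using i by linarith
    then show ?thesis using assms(2) by (simp add: flag_def)
  qed
  then show "(k *v v) $ i = 0" by (simp add: matrix_vector_mult_def sum.neutral del: mult_eq_0_iff)
qed

text \<open>For bilinear \<open>T\<close>, this is the statement that only components of degree at
  least \<open>d\<close> occur, phrased through the flag so that composition with matrices needs no
  index sums.\<close>

definition filtered :: "int \<Rightarrow> 'n::{finite, linorder} btensor \<Rightarrow> bool" where
  "filtered d T \<longleftrightarrow> (\<forall>p q. \<forall>u\<in>flag p. \<forall>v\<in>flag q. T u v \<in> flag (p + q - d))"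

lemma filtered_add: "filtered d S \<Longrightarrow> filtered d T \<Longrightarrow> filtered d (\<lambda>u v. S u v + T u v)"
  and filtered_diff: "filtered d S \<Longrightarrow> filtered d T \<Longrightarrow> filtered d (\<lambda>u v. S u v - T u v)"
  by (simp_all add: filtered_def add_in_flag diff_in_flag)

lemma filtered_swap: "filtered d T \<Longrightarrow> filtered d (\<lambda>u v. T v u)"
  unfolding filtered_def by (metis add.commute)

lemma filtered_value:
  assumes "filtered d T" "strictly_upper k"
  shows "filtered (d + 1) (\<lambda>u v. k *v T u v)"
  using assms by (auto simp: filtered_def diff_diff_eq[symmetric] intro!: strictly_upper_flag)

lemma filtered_left:
  fixes T :: "'n::{finite, linorder} btensor"
  assumes "filtered d T" "strictly_upper k"
  shows "filtered (d + 1) (\<lambda>u v. T (k *v u) v)"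
  unfolding filtered_def
proof (intro allI ballI)
  fix p q and u v :: "(real, 'n) vec"
  assume "u \<in> flag p" "v \<in> flag q"
  then have "T (k *v u) v \<in> flag ((p - 1) + q - d)"
    using assms strictly_upper_flag unfolding filtered_def by blast
  then show "T (k *v u) v \<in> flag (p + q - (d + 1))" by (simp add: algebra_simps)
qed

lemma filtered_right:
  assumes "filtered d T" "strictly_upper k"
  shows "filtered (d + 1) (\<lambda>u v. T u (k *v v))"
  using filtered_swap[OF filtered_left[OF filtered_swap[OF assms(1)] assms(2)]] by simp

text \<open>The matrix \<open>D u\<close> contributes one degree. The other is free: a nonzero
  \<open>u\<close> lies only in flags with \<open>p\<close> at least 1, and for \<open>u = 0\<close>
  linearity gives \<open>D u = 0\<close>.\<close>

lemma filtered_strictly_upper_family: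
  fixes D :: "real ^ 'n::{finite, linorder} \<Rightarrow> 'n sqmat"
  assumes "linear D" "\<And>u. strictly_upper (D u)"
  shows "filtered 2 (\<lambda>u v. D u *v v)"
  unfolding filtered_def
proof (intro allI ballI)
  fix p q and u v :: "(real, 'n) vec"
  assume u: "u \<in> flag p" and v: "v \<in> flag q"
  show "D u *v v \<in> flag (p + q - 2)"
  proof (cases "p \<le> 0")
    case True
    then have "D u = 0" using flag_nonpos[OF u] linear_0[OF assms(1)] by simp
    then show ?thesis by (simp add: zero_in_flag)
  next
    case False
    then show ?thesis by (intro flag_mono[OF strictly_upper_flag[OF assms(2) v]]) simp
  qed
qed

section \<open>Bilinearity and antisymmetry\<close>

lemmas mult_vec_simps =
  matrix_vector_right_distrib matrix_vector_mult_diff_distrib matrix_vector_mult_add_rdistrib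
  matrix_vector_mult_diff_rdistrib matrix_vector_mult_scaleR scaleR_matrix_vector_assoc[symmetric]

lemma bilinear_add: "bilinear S \<Longrightarrow> bilinear T \<Longrightarrow> bilinear (\<lambda>u v. S u v + T u v)"
  and bilinear_diff: "bilinear S \<Longrightarrow> bilinear T \<Longrightarrow> bilinear (\<lambda>u v. S u v - T u v)"
  by (simp_all add: bilinear_def linear_compose_add linear_compose_sub)

lemma bilinear_swap: "bilinear T \<Longrightarrow> bilinear (\<lambda>u v. T v u)"
  by (simp add: bilinear_def)

lemma bilinear_value: "bilinear T \<Longrightarrow> bilinear (\<lambda>u v. k *v T u v)"
  for T :: "'n::finite btensor"
  by (simp add: bilinear_def linear_iff mult_vec_simps)

lemma bilinear_left: "bilinear T \<Longrightarrow> bilinear (\<lambda>u v. T (k *v u) v)"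
  and bilinear_right: "bilinear T \<Longrightarrow> bilinear (\<lambda>u v. T u (k *v v))"
  for T :: "'n::finite btensor"
  by (simp_all add: bilinear_def linear_iff mult_vec_simps)

lemma bilinear_matrix_family: "linear D \<Longrightarrow> bilinear (\<lambda>u v. D u *v v)"
  for D :: "(real, 'n::finite) vec \<Rightarrow> 'n sqmat"
  by (simp add: bilinear_def linear_iff mult_vec_simps)

definition alternating :: "'n::finite btensor \<Rightarrow> bool" where
  "alternating T \<longleftrightarrow> bilinear T \<and> (\<forall>u v. T v u = - T u v)"

text \<open>Both arguments can be replaced by their last-coordinate parts, after which they are
  parallel and antisymmetry kills the value.\<close>

lemma alternating_filtered_eq_0:
  fixes T :: "'n::{finite, linorder} btensor"
  assumes alt: "alternating T" and fil: "filtered d T" and d: "d \<ge> 2 * int CARD('n) - 1"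
  shows "T u v = 0"
proof -
  define e :: "(real, 'n) vec" where "e = axis (Max UNIV) 1"
  define top where "top w = w $ Max UNIV *\<^sub>R e" for w :: "(real, 'n) vec"
  have bil: "bilinear T" and anti: "\<And>u v. T v u = - T u v"
    using alt unfolding alternating_def by blast+
  \<comment> \<open>Without its last coordinate \<open>w\<close> lies in level n - 1, so the value
    lies in level 2n - 1 - d, which is zero by the bound on \<open>d\<close>.\<close>
  have kill: "T (w - top w) z = 0" for w z
  proof (rule flag_nonpos)
    have "w - top w \<in> flag (int CARD('n) - 1)"
      unfolding top_def e_def by (rule diff_top_in_flag)
    then show "T (w - top w) z \<in> flag ((int CARD('n) - 1) + int CARD('n) - d)"
      using fil in_flag_CARD unfolding filtered_def by blast
    show "(int CARD('n) - 1) + int CARD('n) - d \<le> 0" using d by simp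
  qed
  have eq: "T w z = T (top w) z" for w z
    using kill[of w z] bilinear_lsub[OF bil, of w "top w" z] by simp
  have "T e e = 0" using anti[of e e] by (simp add: eq_neg_iff_add_eq_0 flip: scaleR_2)
  then have "T (top u) (top v) = 0"
    by (simp add: top_def bilinear_lmul[OF bil] bilinear_rmul[OF bil])
  \<comment> \<open>The reduction concerns the first argument only; antisymmetry carries it over to
    the second.\<close>
  then show ?thesis
    using eq[of u v] anti[of "top u" v] anti[of "top u" "top v"] eq[of v "top u"] by simp
qed

section \<open>The brackets as algebraic expressions at a point\<close>

definition fn_half :: "'n::finite sqmat \<Rightarrow> 'n sqmat \<Rightarrow> (real ^ 'n \<Rightarrow> 'n sqmat) \<Rightarrow>
    (real ^ 'n \<Rightarrow> 'n sqmat) \<Rightarrow> 'n btensor" where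
  "fn_half k l k' l' u v =
     l' (k *v u) *v v + k' (l *v u) *v v - l *v (k' u *v v) - k *v (l' u *v v)"

text \<open>The pointwise form of the bracket of \<open>K\<close> and \<open>L\<close>, with
  \<open>k'\<close>, \<open>l'\<close> standing for their derivatives at the point.
  \<open>fn_half\<close> collects the terms in which a differentiated operator acts on the second
  vector; those acting on the first are its negated swap.\<close>

definition fn_tensor :: "'n::finite sqmat \<Rightarrow> 'n sqmat \<Rightarrow> (real ^ 'n \<Rightarrow> 'n sqmat) \<Rightarrow>
    (real ^ 'n \<Rightarrow> 'n sqmat) \<Rightarrow> 'n btensor" where
  "fn_tensor k l k' l' u v = fn_half k l k' l' u v - fn_half k l k' l' v u"

definition haantjes_step ::
    "'n::finite sqmat \<Rightarrow> 'n sqmat \<Rightarrow> 'n btensor \<Rightarrow> 'n btensor" where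
  "haantjes_step k l T u v =
     k *v (l *v T u v) + T (k *v u) (l *v v) - l *v T (k *v u) v - k *v T u (l *v v)
     + l *v (k *v T u v) + T (l *v u) (k *v v) - k *v T (l *v u) v - l *v T u (k *v v)"

lemma alternating_fn_tensor:
  assumes "linear k'" "linear l'"
  shows "alternating (fn_tensor k l k' l')"
proof -
  note k' = bilinear_matrix_family[OF assms(1)] and l' = bilinear_matrix_family[OF assms(2)]
  have half: "bilinear (fn_half k l k' l')"
    unfolding fn_half_def[abs_def]
    by (intro bilinear_add bilinear_diff bilinear_value bilinear_left[OF k'] bilinear_left[OF l']
        k' l')
  have "bilinear (fn_tensor k l k' l')"
    unfolding fn_tensor_def[abs_def] by (rule bilinear_diff[OF half bilinear_swap[OF half]])
  then show ?thesis by (simp add: alternating_def fn_tensor_def)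
qed

lemma filtered_fn_tensor:
  assumes "strictly_upper k" "strictly_upper l" "linear k'" "linear l'"
    and "\<And>u. strictly_upper (k' u)" "\<And>u. strictly_upper (l' u)"
  shows "filtered 3 (fn_tensor k l k' l')"
proof -
  have k': "filtered 2 (\<lambda>u v. k' u *v v)" and l': "filtered 2 (\<lambda>u v. l' u *v v)"
    using assms by (auto intro: filtered_strictly_upper_family)
  \<comment> \<open>Each of the four terms composes a derivative family, of degree 2, with exactly
    one further factor \<open>k\<close> or \<open>l\<close>.\<close>
  have "filtered (2 + 1) (fn_half k l k' l')"
    unfolding fn_half_def[abs_def]
    by (intro filtered_add filtered_diff filtered_value filtered_left[OF k'] filtered_left[OF l']
        k' l' assms)
  then have half: "filtered 3 (fn_half k l k' l')" by simp
  show ?thesis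
    unfolding fn_tensor_def[abs_def] by (rule filtered_diff[OF half filtered_swap[OF half]])
qed

text \<open>Exchanging \<open>u\<close> and \<open>v\<close> permutes the eight terms up to sign,
  for instance \<open>T (k *v u) (l *v v)\<close> with \<open>T (l *v u) (k *v v)\<close>, since the
  recursion is symmetric in \<open>k\<close> and \<open>l\<close>.\<close>

lemma alternating_haantjes_step:
  assumes "alternating T"
  shows "alternating (haantjes_step k l T)"
proof -
  have bil: "bilinear T" and anti: "\<And>u v. T v u = - T u v"
    using assms unfolding alternating_def by blast+
  have "haantjes_step k l T v u = - haantjes_step k l T u v" for u v
    unfolding haantjes_step_def
    using anti[of u v] anti[of "k *v u" v] anti[of "l *v u" v] anti[of u "k *v v"]
      anti[of u "l *v v"] anti[of "k *v u" "l *v v"] anti[of "l *v u" "k *v v"]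
    by (simp add: vec.neg)
  moreover have "bilinear (haantjes_step k l T)"
    unfolding haantjes_step_def[abs_def]
    by (intro bilinear_add bilinear_diff bilinear_value bil bilinear_left[OF bil]
        bilinear_right[OF bil] bilinear_left[OF bilinear_right[OF bil]])
  ultimately show ?thesis unfolding alternating_def by blast
qed

lemma filtered_haantjes_step:
  assumes "filtered d T" and k: "strictly_upper k" and l: "strictly_upper l"
  shows "filtered (d + 2) (haantjes_step k l T)"
proof -
  note T = assms(1)
  \<comment> \<open>Every term contains one \<open>k\<close> and one \<open>l\<close>, each raising
    the degree by one.\<close>
  have "filtered (d + 1 + 1) (haantjes_step k l T)"
    unfolding haantjes_step_def[abs_def]
    by (intro filtered_add filtered_diff filtered_value T k l
        filtered_left[OF T] filtered_right[OF T]
        filtered_left[OF filtered_right[OF T l] k] filtered_left[OF filtered_right[OF T k] l])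
  then show ?thesis by (simp add: add.assoc)
qed

section \<open>Tensoriality of the brackets in a chart\<close>

lemma bounded_bilinear_matrix_vector_mult:
  "bounded_bilinear ((*v) :: real ^ 'n ^ 'm \<Rightarrow> real ^ 'n \<Rightarrow> real ^ 'm)"
  by (intro bilinear_conv_bounded_bilinear[THEN iffD1])
     (auto simp: bilinear_def linear_iff mult_vec_simps)

lemma op_apply_at: "(K \<rhd> \<xi>) c x = K c x *v \<xi> c x"
  by (simp add: op_apply_def)

lemma op_apply_has_derivative:
  assumes "K c differentiable at x" "\<xi> c differentiable at x"
  shows "((K \<rhd> \<xi>) c has_derivative (\<lambda>v. K c x *v frechet_derivative (\<xi> c) (at x) v
           + frechet_derivative (K c) (at x) v *v \<xi> c x)) (at x)"
  unfolding op_apply_def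
  by (intro bounded_bilinear.FDERIV[OF bounded_bilinear_matrix_vector_mult]
      assms[unfolded frechet_derivative_works])

lemma op_apply_differentiable:
  assumes "K c differentiable at x" "\<xi> c differentiable at x"
  shows "(K \<rhd> \<xi>) c differentiable at x"
  using op_apply_has_derivative[of K c x \<xi>, OF assms] by (auto simp: differentiable_def)

lemma frechet_derivative_op_apply:
  assumes "K c differentiable at x" "\<xi> c differentiable at x"
  shows "frechet_derivative ((K \<rhd> \<xi>) c) (at x) =
    (\<lambda>v. K c x *v frechet_derivative (\<xi> c) (at x) v
          + frechet_derivative (K c) (at x) v *v \<xi> c x)"
  by (rule frechet_derivative_at[OF op_apply_has_derivative[of K c x \<xi>, OF assms], symmetric])

text \<open>After the Leibniz rule all terms with derivatives of the vector fields cancel, leaving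
  only derivatives of the operators.\<close>

lemma fn_bracket_eq_fn_tensor:
  assumes "K c differentiable at x" "L c differentiable at x"
    and "\<xi> c differentiable at x" "\<eta> c differentiable at x"
  shows "fn_bracket K L \<xi> \<eta> c x =
    fn_tensor (K c x) (L c x) (frechet_derivative (K c) (at x)) (frechet_derivative (L c) (at x))
      (\<xi> c x) (\<eta> c x)"
  unfolding fn_bracket_def
  by (simp add: op_apply_at lie_bracket_def frechet_derivative_op_apply assms
      fn_tensor_def fn_half_def mult_vec_simps)

text \<open>A single \<open>T\<close> must serve all fields differentiable at \<open>x\<close>,
  because the recursion evaluates the previous level at \<open>K \<rhd> \<xi>\<close>,
  \<open>L \<rhd> \<eta>\<close> and the like.\<close>

lemma haantjes_bracket_tensor:
  assumes "K c differentiable at x" "L c differentiable at x"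
    and k: "strictly_upper (K c x)" and l: "strictly_upper (L c x)"
    and "\<And>u. strictly_upper (frechet_derivative (K c) (at x) u)"
    and "\<And>u. strictly_upper (frechet_derivative (L c) (at x) u)"
  shows "\<exists>T. alternating T \<and> filtered (2 * int m + 3) T \<and>
    (\<forall>\<xi> \<eta>. \<xi> c differentiable at x \<longrightarrow> \<eta> c differentiable at x \<longrightarrow>
       haantjes_bracket (Suc m) K L \<xi> \<eta> c x = T (\<xi> c x) (\<eta> c x))"
proof (induction m)
  case 0
  show ?case
    using assms fn_bracket_eq_fn_tensor[of K c x L]
    by (intro exI[of _ "fn_tensor (K c x) (L c x)
          (frechet_derivative (K c) (at x)) (frechet_derivative (L c) (at x))"])
       (simp add: alternating_fn_tensor filtered_fn_tensor linear_frechet_derivative)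
next
  case (Suc m)
  then obtain T where T: "alternating T" "filtered (2 * int m + 3) T"
    and H: "\<And>\<xi> \<eta>. \<xi> c differentiable at x \<Longrightarrow> \<eta> c differentiable at x \<Longrightarrow>
       haantjes_bracket (Suc m) K L \<xi> \<eta> c x = T (\<xi> c x) (\<eta> c x)"
    by blast
  have "haantjes_bracket (Suc (Suc m)) K L \<xi> \<eta> c x =
      haantjes_step (K c x) (L c x) T (\<xi> c x) (\<eta> c x)"
    if "\<xi> c differentiable at x" "\<eta> c differentiable at x" for \<xi> \<eta>
  proof -
    note diff = that op_apply_differentiable[where K = K, OF assms(1)]
      op_apply_differentiable[where K = L, OF assms(2)]
    show ?thesis by (simp add: Let_def haantjes_step_def op_apply_at H diff)
  qed
  moreover have "filtered (2 * int (Suc m) + 3) (haantjes_step (K c x) (L c x) T)"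
    using filtered_haantjes_step[OF T(2) k l] by (simp add: algebra_simps)
  ultimately show ?case using alternating_haantjes_step[OF T(1)] by blast
qed

section \<open>From smooth fields on a chart to the pointwise argument\<close>

lemma smooth_on_differentiable:
  assumes "smooth_on S f" "open S" "x \<in> S"
  shows "f differentiable at x"
proof -
  have "Ck_on (Suc 0) S f" using assms(1) unfolding smooth_on_def by blast
  then have "f differentiable at x within S"
    using assms(3) unfolding Ck_on.simps differentiable_on_def by blast
  then show ?thesis by (simp only: at_within_open[OF assms(3,2)])
qed

text \<open>Entries on and below the diagonal vanish on a whole neighbourhood of \<open>x\<close>,
  so their derivatives vanish there too.\<close>

lemma frechet_derivative_strictly_upper:
  fixes f :: "'a::real_normed_vector \<Rightarrow> 'n::{finite, linorder} sqmat"
  assumes "f differentiable at x" "open S" "x \<in> S" "\<And>y. y \<in> S \<Longrightarrow> strictly_upper (f y)"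
  shows "strictly_upper (frechet_derivative f (at x) u)"
  unfolding strictly_upper_def
proof (intro allI impI)
  fix i j :: 'n
  assume "j \<le> i"
  have "(f has_derivative frechet_derivative f (at x)) (at x)"
    using assms(1) frechet_derivative_works by blast
  then have "((\<lambda>y. f y $ i $ j) has_derivative (\<lambda>u. frechet_derivative f (at x) u $ i $ j)) (at x)"
    by (intro bounded_linear.has_derivative[OF bounded_linear_vec_nth])
  moreover have "((\<lambda>y. f y $ i $ j) has_derivative (\<lambda>u. 0)) (at x)"
    using assms \<open>j \<le> i\<close>
    by (intro has_derivative_transform_within_open[OF has_derivative_const, of S])
       (auto simp: strictly_upper_def)
  ultimately show "frechet_derivative f (at x) u $ i $ j = 0"
    using has_derivative_unique by metis
qed

theorem theorem3:
  fixes A :: "('m::{t2_space, second_countable_topology}, 'n::{finite, linorder}) chart set"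
    and c :: "('m, 'n) chart"
    and K L :: "('m, 'n) opfield"
  assumes "CARD('n) \<ge> 2"
    and "smooth_structure A"
    and "operator_field A K" and "operator_field A L"
    and "commuting_operators A K L"
    and "c \<in> A"
    and "strictly_upper_triangular_in c K" and "strictly_upper_triangular_in c L"
  shows "haantjes_vanishes_on_chart A c (CARD('n) - 1) K L"
  unfolding haantjes_vanishes_on_chart_def
proof (intro allI impI ballI)
  fix \<xi> \<eta> :: "('m, 'n) vfield" and x
  assume \<xi>: "vector_field_on A (fst c) \<xi>" and \<eta>: "vector_field_on A (fst c) \<eta>"
    and x: "x \<in> chart_img c UNIV"
  define S where "S = chart_img c UNIV"
  have S: "open S" "x \<in> S" and S_eq: "chart_img c (fst c) = S"
    using assms(2,6) x by (auto simp: S_def chart_img_def smooth_structure_def is_chart_def)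
  have diff: "K c differentiable at x" "L c differentiable at x"
      "\<xi> c differentiable at x" "\<eta> c differentiable at x"
    using assms(3,4,6) \<xi> \<eta> S_eq
    by (auto simp: operator_field_def vector_field_on_def S_def
        intro!: smooth_on_differentiable[OF _ S])
  have up: "strictly_upper (K c y)" "strictly_upper (L c y)" if "y \<in> S" for y
    using assms(7,8) that
    by (auto simp: strictly_upper_triangular_in_def strictly_upper_def S_def)
  \<comment> \<open>Level n - 1 is \<open>Suc m\<close>, the subtraction being exact because n is at
    least 2; the degree \<open>2 * int m + 3\<close> then equals 2n - 1, the bound needed for
    vanishing.\<close>
  define m where "m = CARD('n) - 2"
  have m: "CARD('n) - 1 = Suc m" "2 * int m + 3 = 2 * int CARD('n) - 1"
    using assms(1) by (auto simp: m_def)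
  have "strictly_upper (frechet_derivative (K c) (at x) u)"
    "strictly_upper (frechet_derivative (L c) (at x) u)" for u
    using frechet_derivative_strictly_upper[OF _ S] diff(1,2) up by blast+
  then obtain T where "alternating T" "filtered (2 * int m + 3) T"
    and T: "haantjes_bracket (Suc m) K L \<xi> \<eta> c x = T (\<xi> c x) (\<eta> c x)"
    using haantjes_bracket_tensor[of K c x L m] diff up[OF S(2)] by blast
  then have "T (\<xi> c x) (\<eta> c x) = 0"
    using m(2) by (intro alternating_filtered_eq_0) auto
  then show "haantjes_bracket (CARD('n) - 1) K L \<xi> \<eta> c x = 0"
    using T m(1) by simp
qed

end
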